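(* Let $G\subseteq\mathbb{P}$ be a $\mathcal{D}$-generic ideal, where $\mathcal{D}=\mathcal{T}\cup\mathcal{S}\cup\mathcal{G}$, and let $(\cdot)^{\star}:=\bigcup G$. Let $\mathcal{V}^{\star}=(V^{\star},\in^{\star})$ where for all $i,j\in\mathbb{Z}$, $\mathsf{c}_i\in^{\star}\mathsf{c}_j$ iff $\mathsf{c}_i\in\mathsf{c}_j^{\star}$. Then: (1) $(\cdot)^{\star}:V^{\star}\to\mathcal{X}$ is a bijection, and $\mathcal{V}^{\star}\models\mathsf{WD}+\mathsf{EXT}+\mathsf{BU}+\mathsf{BI}$; (2) for all $k,\ell\in\mathbb{Z}$ there exists an automorphism $F^k_\ell:\mathcal{V}^{\star}\to\mathcal{V}^{\star}$ such that $F^k_\ell(\mathsf{c}_k)=\mathsf{c}_\ell$.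
   Context: For each $k\in\mathbb{Z}$ let $\mathsf{c}_k$ be a distinct constant symbol, and $V^{\star}=\{\mathsf{c}_k:k\in\mathbb{Z}\}$. Let $\omega$ be the set of nonnegative integers and $\mathcal{X}$ the set of all $X\subseteq V^{\star}$ whose symmetric difference with $\{\mathsf{c}_k:k\in\omega\}$ is finite. Let $\mathbb{P}$ be the set of all partial one-to-one maps $\sigma$ from $V^{\star}$ to $\mathcal{X}$ (domain $\mathrm{dom}(\sigma)\subseteq V^{\star}$) such that (a) $u\in\sigma(u)$ for all $u\in\mathrm{dom}(\sigma)$, and (b) both $\bigcap\sigma[\mathrm{dom}(\sigma)]\setminus\mathrm{dom}(\sigma)$ and $V^{\star}\setminus\bigcup\sigma[\mathrm{dom}(\sigma)]$ are infinite. Order $\mathbb{P}$ by $\sigma\subseteq\tau$ iff $\sigma$ is a restriction of $\tau$. For a family $\Gamma$ of subsets of $\mathbb{P}$, a nonempty $G\subseteq\mathbb{P}$ is a $\Gamma$-generic ideal if $G$ is downward closed under $\subseteq$ (within $\mathbb{P}$), upward directed (any two elements of $G$ have a common extension in $G$), and $G\cap D\neq\emptyset$ for all $D\in\Gamma$. Let $\mathcal{T}=\{T_k:k\in\mathbb{Z}\}$ with $T_k=\{\sigma\in\mathbb{P}:\sigma(\mathsf{c}_k)\text{ is defined}\}$, and $\mathcal{S}=\{S_X:X\in\mathcal{X}\}$ with $S_X=\{\sigma\in\mathbb{P}:\exists k\in\mathbb{Z}\ \sigma(\mathsf{c}_k)=X\}$. For $\sigma\in\mathbb{P}$ and $x_0,\dots,x_n\in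 V^{\star}$, $\Delta(\sigma;x_0,\dots,x_n)$ is the smallest $W\subseteq V^{\star}$ such that: (1) $\{x_0,\dots,x_n\}\subseteq W$; (2) $\sigma(u)\setminus\sigma(v)\subseteq W$ for all $u,v\in W\cap\mathrm{dom}(\sigma)$; (3) if $v\in\mathrm{dom}(\sigma)$ and $\sigma(v)=(\sigma(u)\setminus A)\cup B$ for some $u\in W$ and finite $A,B\subseteq W$, then $v\in W$. The sequence $x_0,\dots,x_n$ is $\mathsf{Good}_1(\sigma)$ if (i) $\sigma$ is defined on all of $\Delta(\sigma;\vec{x})$, and (ii) for every $u\in\Delta(\sigma;\vec{x})$ and all finite $A,B\subseteq\Delta(\sigma;\vec{x})$ there is $v\in\Delta(\sigma;\vec{x})$ with $\sigma(v)=(\sigma(u)\setminus A)\cup B$. The relation $\in^{\sigma}$ on $V^{\star}$ is defined by $\mathsf{c}_i\in^{\sigma}\mathsf{c}_j$ iff $\mathsf{c}_j\in\mathrm{dom}(\sigma)$ and $\mathsf{c}_i\in\sigma(\mathsf{c}_j)$. A (possibly empty) sequence $(x_0,y_0),\dots,(x_m,y_m)$ of pairs of elements of $V^{\star}$ is $\mathsf{Good}_2(\sigma)$ if both $x_0,\dots,x_m$ and $y_0,\dots,y_m$ are $\mathsf{Good}_1(\sigma)$ and there is an isomorphism $f:(\Delta(\sigma;\vec{x}),\in^{\sigma})\to(\Delta(\sigma;\vec{y}),\in^{\sigma})$ such that $f(x_i)=y_i$ for all $i\le m$. For each finite (possibly empty) sequence $(a_0,b_0),\dots,(a_m,b_m)$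 of pairs of elements of $V^{\star}$ and each $a_{m+1}\in V^{\star}$, let $\mathcal{G}((a_0,b_0),\dots,(a_m,b_m);a_{m+1})$ be the set of all $\sigma\in\mathbb{P}$ such that either there exists $b_{m+1}\in V^{\star}$ with $(a_0,b_0),\dots,(a_{m+1},b_{m+1})$ being $\mathsf{Good}_2(\sigma)$, or there is no $\tau\in\mathbb{P}$ with $\sigma\subseteq\tau$ such that $(a_0,b_0),\dots,(a_m,b_m)$ is $\mathsf{Good}_2(\tau)$; $\mathcal{G}$ is the family of all these sets. $\mathsf{WD}$ is the theory with axioms $\forall x y\,\exists z\,\forall u\,[u\in z\leftrightarrow(u\in x\vee u=y)]$ and $\forall x y\,\exists z\,\forall u\,[u\in z\leftrightarrow(u\in x\wedge u\neq y)]$; $\mathsf{EXT}$ is $\forall x y\,[\forall u\,(u\in x\leftrightarrow u\in y)\rightarrow x=y]$; $\mathsf{BU}$ is $\forall x y\,\exists z\,\forall u\,[u\in z\leftrightarrow(u\in x\vee u\in y)]$; $\mathsf{BI}$ is $\forall x y\,\exists z\,\forall u\,[u\in z\leftrightarrow(u\in x\wedge u\in y)]$. *)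

theory Defs
  imports Main
begin

datatype const = Cst int

definition XX :: "const set set" where
  "XX = {X. finite ((X - Cst ` {0..}) \<union> (Cst ` {0..} - X))}"

type_synonym pmap = "const \<Rightarrow> const set option"

text \<open>For the empty map the intersection below is the whole set of constants, so the
  empty map is a condition.\<close>

definition PP :: "pmap set" where
  "PP = {\<sigma>. ran \<sigma> \<subseteq> XX \<and> inj_on \<sigma> (dom \<sigma>)
          \<and> (\<forall>u\<in>dom \<sigma>. u \<in> the (\<sigma> u))
          \<and> infinite (\<Inter>(ran \<sigma>) - dom \<sigma>)
          \<and> infinite (UNIV - \<Union>(ran \<sigma>))}"

definition generic_ideal :: "pmap set set \<Rightarrow> pmap set \<Rightarrow> bool" where
  "generic_ideal \<Gamma> G \<longleftrightarrow>
     G \<subseteq> PP \<and> G \<noteq> {}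
     \<and> (\<forall>\<tau>\<in>G. \<forall>\<sigma>\<in>PP. \<sigma> \<subseteq>\<^sub>m \<tau> \<longrightarrow> \<sigma> \<in> G)
     \<and> (\<forall>\<sigma>\<in>G. \<forall>\<tau>\<in>G. \<exists>\<rho>\<in>G. \<sigma> \<subseteq>\<^sub>m \<rho> \<and> \<tau> \<subseteq>\<^sub>m \<rho>)
     \<and> (\<forall>D\<in>\<Gamma>. G \<inter> D \<noteq> {})"

definition T_family :: "pmap set set" where
  "T_family = {{\<sigma>\<in>PP. Cst k \<in> dom \<sigma>} |k. True}"

definition S_family :: "pmap set set" where
  "S_family = {{\<sigma>\<in>PP. \<exists>k. \<sigma> (Cst k) = Some X} |X. X \<in> XX}"

definition closed_under :: "pmap \<Rightarrow> const set \<Rightarrow> bool" where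
  "closed_under \<sigma> W \<longleftrightarrow>
     (\<forall>u\<in>W \<inter> dom \<sigma>. \<forall>v\<in>W \<inter> dom \<sigma>. the (\<sigma> u) - the (\<sigma> v) \<subseteq> W)
     \<and> (\<forall>u\<in>W \<inter> dom \<sigma>. \<forall>v\<in>dom \<sigma>. \<forall>A B.
          finite A \<and> A \<subseteq> W \<and> finite B \<and> B \<subseteq> W
          \<and> the (\<sigma> v) = (the (\<sigma> u) - A) \<union> B \<longrightarrow> v \<in> W)"

definition Delta :: "pmap \<Rightarrow> const list \<Rightarrow> const set" where
  "Delta \<sigma> xs = (LEAST W. set xs \<subseteq> W \<and> closed_under \<sigma> W)"

text \<open>The least such set exists, because the closure conditions are preserved by
  arbitrary intersections.\<close>

lemma closed_under_Inter:
  assumes "\<And>W. W \<in> F \<Longrightarrow> closed_under \<sigma> W"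
  shows "closed_under \<sigma> (\<Inter>F)"
  unfolding closed_under_def
proof (intro conjI ballI allI impI)
  fix u v assume "u \<in> \<Inter>F \<inter> dom \<sigma>" "v \<in> \<Inter>F \<inter> dom \<sigma>"
  then show "the (\<sigma> u) - the (\<sigma> v) \<subseteq> \<Inter>F"
    using assms unfolding closed_under_def by (intro Inter_greatest) blast
next
  fix u v A B
  assume u: "u \<in> \<Inter>F \<inter> dom \<sigma>" and v: "v \<in> dom \<sigma>"
    and AB: "finite A \<and> A \<subseteq> \<Inter>F \<and> finite B \<and> B \<subseteq> \<Inter>F
      \<and> the (\<sigma> v) = (the (\<sigma> u) - A) \<union> B"
  show "v \<in> \<Inter>F"
  proof
    fix W assume W: "W \<in> F"
    then have "u \<in> W \<inter> dom \<sigma>" "A \<subseteq> W" "B \<subseteq> W" using u AB by auto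
    then show "v \<in> W" using assms[OF W] v AB unfolding closed_under_def by blast
  qed
qed

lemma Delta_eq_Inter: "Delta \<sigma> xs = \<Inter>{W. set xs \<subseteq> W \<and> closed_under \<sigma> W}"
  unfolding Delta_def
  by (rule Least_equality) (auto intro!: closed_under_Inter)

definition Good1 :: "pmap \<Rightarrow> const list \<Rightarrow> bool" where
  "Good1 \<sigma> xs \<longleftrightarrow>
     Delta \<sigma> xs \<subseteq> dom \<sigma>
     \<and> (\<forall>u\<in>Delta \<sigma> xs. \<forall>A B.
          finite A \<and> A \<subseteq> Delta \<sigma> xs \<and> finite B \<and> B \<subseteq> Delta \<sigma> xs \<longrightarrow>
          (\<exists>v\<in>Delta \<sigma> xs. the (\<sigma> v) = (the (\<sigma> u) - A) \<union> B))"

definition mem_of :: "pmap \<Rightarrow> const \<Rightarrow> const \<Rightarrow> bool" where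
  "mem_of \<sigma> u v \<longleftrightarrow> v \<in> dom \<sigma> \<and> u \<in> the (\<sigma> v)"

definition isomorphism ::
  "('a \<Rightarrow> 'b) \<Rightarrow> 'a set \<Rightarrow> ('a \<Rightarrow> 'a \<Rightarrow> bool) \<Rightarrow> 'b set \<Rightarrow> ('b \<Rightarrow> 'b \<Rightarrow> bool) \<Rightarrow> bool" where
  "isomorphism f A R B S \<longleftrightarrow>
     bij_betw f A B \<and> (\<forall>u\<in>A. \<forall>v\<in>A. R u v \<longleftrightarrow> S (f u) (f v))"

definition Good2 :: "pmap \<Rightarrow> (const \<times> const) list \<Rightarrow> bool" where
  "Good2 \<sigma> ps \<longleftrightarrow>
     Good1 \<sigma> (map fst ps) \<and> Good1 \<sigma> (map snd ps)
     \<and> (\<exists>f. isomorphism f (Delta \<sigma> (map fst ps)) (mem_of \<sigma>)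
                          (Delta \<sigma> (map snd ps)) (mem_of \<sigma>)
            \<and> (\<forall>(x, y)\<in>set ps. f x = y))"

definition G_family :: "pmap set set" where
  "G_family =
     {{\<sigma>\<in>PP. (\<exists>b. Good2 \<sigma> (ps @ [(a, b)]))
             \<or> \<not> (\<exists>\<tau>\<in>PP. \<sigma> \<subseteq>\<^sub>m \<tau> \<and> Good2 \<tau> ps)} |ps a. True}"

text \<open>The union of a set of partial maps, as a set of argument-value pairs.\<close>

definition star :: "pmap set \<Rightarrow> (const \<times> const set) set" where
  "star G = \<Union>(Map.graph ` G)"

definition mem_star :: "pmap set \<Rightarrow> const \<Rightarrow> const \<Rightarrow> bool" where
  "mem_star G u v \<longleftrightarrow> (\<exists>X. (v, X) \<in> star G \<and> u \<in> X)"

text \<open>Satisfaction of the axioms in the structure whose universe is the type \<open>'a\<close> and whose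
  membership relation is \<open>E\<close>.\<close>

definition sat_WD :: "('a \<Rightarrow> 'a \<Rightarrow> bool) \<Rightarrow> bool" where
  "sat_WD E \<longleftrightarrow>
     (\<forall>x y. \<exists>z. \<forall>u. E u z \<longleftrightarrow> (E u x \<or> u = y))
     \<and> (\<forall>x y. \<exists>z. \<forall>u. E u z \<longleftrightarrow> (E u x \<and> u \<noteq> y))"

definition sat_EXT :: "('a \<Rightarrow> 'a \<Rightarrow> bool) \<Rightarrow> bool" where
  "sat_EXT E \<longleftrightarrow> (\<forall>x y. (\<forall>u. E u x \<longleftrightarrow> E u y) \<longrightarrow> x = y)"

definition sat_BU :: "('a \<Rightarrow> 'a \<Rightarrow> bool) \<Rightarrow> bool" where
  "sat_BU E \<longleftrightarrow> (\<forall>x y. \<exists>z. \<forall>u. E u z \<longleftrightarrow> (E u x \<or> E u y))"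

definition sat_BI :: "('a \<Rightarrow> 'a \<Rightarrow> bool) \<Rightarrow> bool" where
  "sat_BI E \<longleftrightarrow> (\<forall>x y. \<exists>z. \<forall>u. E u z \<longleftrightarrow> (E u x \<and> E u y))"

end

theory Submission imports Defs "HOL-Library.Nat_Bijection" begin

text \<open>If \<open>x\<close> is good for \<open>\<sigma>\<close>, then \<open>\<Delta>(\<sigma>; x)\<close> consists of the elements whose value is
  \<open>\<sigma>(x)\<close> minus a finite subset of \<open>\<Delta>(\<sigma>; x)\<close>: as \<open>v \<in> \<sigma>(v)\<close>, nothing outside \<open>\<sigma>(x)\<close>
  ever has to be added.  Hence \<open>\<Delta>(\<sigma>; x)\<close> with \<open>\<in>\<^sup>\<sigma>\<close> is a copy of the hereditarily finite
  sets with the relation \<open>\<notin>\<close>, in which \<open>x\<close> plays the role of the empty set, and any two good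
  elements \<open>x\<close>, \<open>y\<close> form a good pair.  Good pairs persist in extensions, so the genericity
  conditions extend the pair \<open>(c\<^sub>k, c\<^sub>l)\<close> to an automorphism by going back and forth.\<close>

section \<open>Closures, goodness, and their persistence in extensions\<close>

lemma closed_underD1:
  assumes "closed_under \<sigma> W" "u \<in> W" "u \<in> dom \<sigma>" "v \<in> W" "v \<in> dom \<sigma>"
  shows "the (\<sigma> u) - the (\<sigma> v) \<subseteq> W"
  using assms unfolding closed_under_def by (elim conjE) (drule bspec, blast, drule bspec, blast)

lemma closed_underD2:
  assumes "closed_under \<sigma> W" "u \<in> W" "u \<in> dom \<sigma>" "v \<in> dom \<sigma>"
    "finite A" "A \<subseteq> W" "finite B" "B \<subseteq> W" "the (\<sigma> v) = (the (\<sigma> u) - A) \<union> B"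
  shows "v \<in> W"
  using assms(1)[unfolded closed_under_def, THEN conjunct2, THEN bspec, THEN bspec,
      THEN spec, THEN spec, THEN mp, of u v A B] assms(2-9) by blast

lemma Delta_least: "set xs \<subseteq> W \<Longrightarrow> closed_under \<sigma> W \<Longrightarrow> Delta \<sigma> xs \<subseteq> W"
  unfolding Delta_eq_Inter by blast

lemma set_subset_Delta: "set xs \<subseteq> Delta \<sigma> xs"
  unfolding Delta_eq_Inter by blast

lemma closed_under_Delta: "closed_under \<sigma> (Delta \<sigma> xs)"
  unfolding Delta_eq_Inter by (rule closed_under_Inter) blast

lemma PP_inj:
  assumes "\<sigma> \<in> PP" "u \<in> dom \<sigma>" "v \<in> dom \<sigma>" "the (\<sigma> u) = the (\<sigma> v)"
  shows "u = v"
proof -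
  have "\<sigma> u = \<sigma> v" using assms(2-4) by auto
  then show ?thesis using assms(1-3) unfolding PP_def inj_on_def by blast
qed

lemma map_le_value: "\<sigma> \<subseteq>\<^sub>m \<tau> \<Longrightarrow> u \<in> dom \<sigma> \<Longrightarrow> \<tau> u = \<sigma> u"
  unfolding map_le_def by simp

lemma Good1D:
  assumes "Good1 \<sigma> xs" "u \<in> Delta \<sigma> xs"
    "finite A" "A \<subseteq> Delta \<sigma> xs" "finite B" "B \<subseteq> Delta \<sigma> xs"
  shows "\<exists>v\<in>Delta \<sigma> xs. the (\<sigma> v) = (the (\<sigma> u) - A) \<union> B"
  using assms(1)[unfolded Good1_def, THEN conjunct2, THEN bspec, THEN spec, THEN spec, THEN mp]
    assms(2-6) by blast

text \<open>Each closure condition for \<open>\<sigma>\<close> is also one for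
  \<open>\<tau>\<close>, because the two maps agree on \<open>dom \<sigma>\<close>; so every set
  closed under \<open>\<tau>\<close> is closed under \<open>\<sigma>\<close>.\<close>

lemma Delta_mono:
  assumes "\<sigma> \<subseteq>\<^sub>m \<tau>"
  shows "Delta \<sigma> xs \<subseteq> Delta \<tau> xs"
proof (rule Delta_least)
  show "set xs \<subseteq> Delta \<tau> xs" by (rule set_subset_Delta)
  have le: "dom \<sigma> \<subseteq> dom \<tau>" using assms by (rule map_le_implies_dom_le)
  have cl: "closed_under \<tau> (Delta \<tau> xs)" by (rule closed_under_Delta)
  show "closed_under \<sigma> (Delta \<tau> xs)"
    unfolding closed_under_def
  proof (intro conjI ballI allI impI)
    fix u v assume uv: "u \<in> Delta \<tau> xs \<inter> dom \<sigma>" "v \<in> Delta \<tau> xs \<inter> dom \<sigma>"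
    then have "the (\<tau> u) - the (\<tau> v) \<subseteq> Delta \<tau> xs"
      using closed_underD1[OF cl] le by blast
    moreover have "\<tau> u = \<sigma> u" "\<tau> v = \<sigma> v"
      using uv map_le_value[OF assms] by blast+
    ultimately show "the (\<sigma> u) - the (\<sigma> v) \<subseteq> Delta \<tau> xs" by simp
  next
    fix u v A B
    assume u: "u \<in> Delta \<tau> xs \<inter> dom \<sigma>" and v: "v \<in> dom \<sigma>"
      and AB: "finite A \<and> A \<subseteq> Delta \<tau> xs \<and> finite B \<and> B \<subseteq> Delta \<tau> xs
        \<and> the (\<sigma> v) = (the (\<sigma> u) - A) \<union> B"
    have "\<tau> u = \<sigma> u" "\<tau> v = \<sigma> v"
      using u v map_le_value[OF assms] by blast+
    then have "the (\<tau> v) = (the (\<tau> u) - A) \<union> B" using AB by simp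
    moreover have "u \<in> Delta \<tau> xs" "u \<in> dom \<tau>" "v \<in> dom \<tau>" using u v le by blast+
    ultimately show "v \<in> Delta \<tau> xs" using closed_underD2[OF cl] AB by metis
  qed
qed

text \<open>Goodness saturates the closure. Any \<open>v\<close> that the second closure condition
  would add for \<open>\<tau>\<close> has the value of some \<open>w\<close> already present, so
  \<open>v = w\<close> by injectivity of \<open>\<tau>\<close>. The first condition adds nothing,
  since \<open>\<tau>\<close> agrees with \<open>\<sigma>\<close> on the whole closure.\<close>

lemma Good1_mono:
  assumes le: "\<sigma> \<subseteq>\<^sub>m \<tau>" and \<tau>: "\<tau> \<in> PP" and good: "Good1 \<sigma> xs"
  shows "Delta \<tau> xs = Delta \<sigma> xs" and "Good1 \<tau> xs"
proof -
  let ?W = "Delta \<sigma> xs"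
  have dom: "dom \<sigma> \<subseteq> dom \<tau>" using le by (rule map_le_implies_dom_le)
  have W: "?W \<subseteq> dom \<sigma>" using good unfolding Good1_def by simp
  have eq: "\<tau> u = \<sigma> u" if "u \<in> ?W" for u
    using that W map_le_value[OF le] by blast
  have ex: "\<exists>v\<in>?W. the (\<tau> v) = (the (\<tau> u) - A) \<union> B"
    if u: "u \<in> ?W" and AB: "finite A" "A \<subseteq> ?W" "finite B" "B \<subseteq> ?W" for u A B
  proof -
    obtain v where v: "v \<in> ?W" "the (\<sigma> v) = (the (\<sigma> u) - A) \<union> B"
      using Good1D[OF good u AB] by blast
    then have "the (\<tau> v) = (the (\<tau> u) - A) \<union> B" using eq u by simp
    then show ?thesis using v(1) by (rule bexI)
  qed
  have "closed_under \<tau> ?W"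
    unfolding closed_under_def
  proof (intro conjI ballI allI impI)
    fix u v assume uv: "u \<in> ?W \<inter> dom \<tau>" "v \<in> ?W \<inter> dom \<tau>"
    then have "the (\<sigma> u) - the (\<sigma> v) \<subseteq> ?W"
      using W by (intro closed_underD1[OF closed_under_Delta]) auto
    then show "the (\<tau> u) - the (\<tau> v) \<subseteq> ?W" using uv eq by simp
  next
    fix u v A B
    assume u: "u \<in> ?W \<inter> dom \<tau>" and v: "v \<in> dom \<tau>"
      and AB: "finite A \<and> A \<subseteq> ?W \<and> finite B \<and> B \<subseteq> ?W
        \<and> the (\<tau> v) = (the (\<tau> u) - A) \<union> B"
    obtain w where w: "w \<in> ?W" "the (\<tau> w) = (the (\<tau> u) - A) \<union> B"
      using ex[of u A B] u AB by auto
    have "w \<in> dom \<tau>" using w(1) W dom by blast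
    then have "v = w" by (rule PP_inj[OF \<tau> v]) (use w(2) AB in simp)
    then show "v \<in> ?W" using w by simp
  qed
  then have "Delta \<tau> xs \<subseteq> ?W" by (rule Delta_least[OF set_subset_Delta])
  then show D: "Delta \<tau> xs = ?W" using Delta_mono[OF le] by blast
  show "Good1 \<tau> xs"
    unfolding Good1_def D
  proof (intro conjI ballI allI impI)
    show "?W \<subseteq> dom \<tau>" using W dom by (rule subset_trans)
  qed (simp add: ex)
qed

lemma isomorphismD:
  "isomorphism f A R B S \<Longrightarrow> u \<in> A \<Longrightarrow> v \<in> A \<Longrightarrow> R u v \<longleftrightarrow> S (f u) (f v)"
  unfolding isomorphism_def by simp

text \<open>The same \<open>f\<close> works: both closures are unchanged and lie in
  \<open>dom \<sigma>\<close>, where extending the map does not alter membership.\<close>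

lemma Good2_mono:
  assumes le: "\<sigma> \<subseteq>\<^sub>m \<tau>" and \<tau>: "\<tau> \<in> PP" and good: "Good2 \<sigma> ps"
  shows "Good2 \<tau> ps"
proof -
  have g1: "Good1 \<sigma> (map fst ps)" and g2: "Good1 \<sigma> (map snd ps)"
    using good unfolding Good2_def by auto
  obtain f where f: "isomorphism f (Delta \<sigma> (map fst ps)) (mem_of \<sigma>)
                       (Delta \<sigma> (map snd ps)) (mem_of \<sigma>)" "\<forall>(x, y)\<in>set ps. f x = y"
    using good unfolding Good2_def by blast
  have eq: "mem_of \<tau> u v \<longleftrightarrow> mem_of \<sigma> u v" if "v \<in> dom \<sigma>" for u v
    using that map_le_value[OF le that] unfolding mem_of_def by auto
  have sub: "Delta \<sigma> (map fst ps) \<subseteq> dom \<sigma>" "Delta \<sigma> (map snd ps) \<subseteq> dom \<sigma>"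
    using g1 g2 unfolding Good1_def by auto
  have bij: "bij_betw f (Delta \<sigma> (map fst ps)) (Delta \<sigma> (map snd ps))"
    using f(1) unfolding isomorphism_def by (rule conjunct1)
  have "mem_of \<tau> u v \<longleftrightarrow> mem_of \<tau> (f u) (f v)"
    if u: "u \<in> Delta \<sigma> (map fst ps)" and v: "v \<in> Delta \<sigma> (map fst ps)" for u v
  proof -
    have "v \<in> dom \<sigma>" using v sub(1) by blast
    moreover have "f v \<in> dom \<sigma>" using bij_betw_apply[OF bij v] sub(2) by blast
    ultimately show ?thesis using isomorphismD[OF f(1) u v] by (simp only: eq)
  qed
  then have "isomorphism f (Delta \<sigma> (map fst ps)) (mem_of \<tau>)
                       (Delta \<sigma> (map snd ps)) (mem_of \<tau>)"
    unfolding isomorphism_def using bij by blast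
  then show ?thesis
    using f(2) Good1_mono[OF le \<tau> g1] Good1_mono[OF le \<tau> g2] unfolding Good2_def by auto
qed

lemma isomorphism_inv_into:
  assumes "isomorphism f A R B S"
  shows "isomorphism (inv_into A f) B S A R"
  unfolding isomorphism_def
proof (intro conjI ballI)
  have bij: "bij_betw f A B" using assms unfolding isomorphism_def by simp
  then show "bij_betw (inv_into A f) B A" by (rule bij_betw_inv_into)
  fix u v assume "u \<in> B" "v \<in> B"
  then have "inv_into A f u \<in> A" "f (inv_into A f u) = u"
    "inv_into A f v \<in> A" "f (inv_into A f v) = v"
    using bij by (auto simp: bij_betw_def inv_into_into f_inv_into_f)
  then show "S u v \<longleftrightarrow> R (inv_into A f u) (inv_into A f v)"
    using isomorphismD[OF assms] by simp
qed

text \<open>The inverse isomorphism witnesses this. The sets in \<open>G_family\<close> only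
  prescribe extension on the first coordinate; this symmetry supplies the other direction.\<close>

lemma Good2_swap:
  assumes "Good2 \<sigma> ps"
  shows "Good2 \<sigma> (map prod.swap ps)"
proof -
  let ?A = "Delta \<sigma> (map fst ps)" and ?B = "Delta \<sigma> (map snd ps)"
  obtain f where f: "isomorphism f ?A (mem_of \<sigma>) ?B (mem_of \<sigma>)" "\<forall>(x, y)\<in>set ps. f x = y"
    using assms unfolding Good2_def by blast
  have "inv_into ?A f y = x" if "(x, y) \<in> set ps" for x y
  proof -
    have "x \<in> ?A" using set_subset_Delta[of "map fst ps" \<sigma>] that by force
    moreover have "f x = y" using f(2) that by auto
    ultimately show ?thesis
      using f(1) unfolding isomorphism_def by (auto simp: bij_betw_def)
  qed
  then have "\<forall>(y, x)\<in>set (map prod.swap ps). inv_into ?A f y = x" by auto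
  moreover have "map fst (map prod.swap ps) = map snd ps" "map snd (map prod.swap ps) = map fst ps"
    by auto
  ultimately show ?thesis
    using assms isomorphism_inv_into[OF f(1)] unfolding Good2_def by metis
qed

text \<open>Listed elements lie in the closures, so a good list acts as a finite partial
  isomorphism; this is all that the back-and-forth construction uses of it.\<close>

lemma Good2_pairs:
  assumes "Good2 \<sigma> ps" "(x, y) \<in> set ps" "(x', y') \<in> set ps"
  shows "x = x' \<longleftrightarrow> y = y'" and "mem_of \<sigma> x x' \<longleftrightarrow> mem_of \<sigma> y y'"
    and "x \<in> dom \<sigma>" and "y \<in> dom \<sigma>"
proof -
  let ?A = "Delta \<sigma> (map fst ps)" and ?B = "Delta \<sigma> (map snd ps)"
  obtain f where f: "isomorphism f ?A (mem_of \<sigma>) ?B (mem_of \<sigma>)" "\<forall>(x, y)\<in>set ps. f x = y"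
    using assms(1) unfolding Good2_def by blast
  have A: "x \<in> ?A" "x' \<in> ?A" using set_subset_Delta[of "map fst ps" \<sigma>] assms(2,3) by force+
  have B: "y \<in> ?B" using set_subset_Delta[of "map snd ps" \<sigma>] assms(2) by force
  have y: "y = f x" "y' = f x'" using f(2) assms(2,3) by auto
  show "x = x' \<longleftrightarrow> y = y'"
    using f(1) A unfolding y isomorphism_def bij_betw_def by (metis inj_on_eq_iff)
  show "mem_of \<sigma> x x' \<longleftrightarrow> mem_of \<sigma> y y'"
    using f(1) A unfolding y isomorphism_def by blast
  show "x \<in> dom \<sigma>" "y \<in> dom \<sigma>"
    using assms(1) A(1) B unfolding Good2_def Good1_def by auto
qed

section \<open>The structure generated by a single good element\<close>

text \<open>A binary digit at position \<open>m\<close> gives \<open>m < 2 ^ m \<le> n\<close>. This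
  makes recursion and induction along binary digits well-founded.\<close>

lemma mem_set_decode_less: "m \<in> set_decode n \<Longrightarrow> m < n"
proof -
  assume "m \<in> set_decode n"
  then have "n div 2 ^ m \<noteq> 0" unfolding set_decode_def by (auto intro: ccontr)
  then have "2 ^ m \<le> n" by (metis div_less not_less)
  then show "m < n" using less_exp[of m] by linarith
qed

text \<open>The Ackermann coding of hereditarily finite sets: the element with code \<open>n\<close> lacks exactly
  the elements whose codes are the binary digits of \<open>n\<close>.\<close>

function hf_elem :: "pmap \<Rightarrow> const \<Rightarrow> nat \<Rightarrow> const" where
  "hf_elem \<sigma> x n =
     (SOME v. v \<in> Delta \<sigma> [x] \<and> the (\<sigma> v) = the (\<sigma> x) - hf_elem \<sigma> x ` set_decode n)"
  by auto
termination
  by (relation "measure (\<lambda>(\<sigma>, x, n). n)") (auto simp: mem_set_decode_less)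

declare hf_elem.simps [simp del]

context
  fixes \<sigma> x
  assumes \<sigma>: "\<sigma> \<in> PP" and good: "Good1 \<sigma> [x]"
begin

lemma Delta_dom: "Delta \<sigma> [x] \<subseteq> dom \<sigma>"
  using good unfolding Good1_def by simp

text \<open>Goodness with \<open>B = {}\<close> provides an element to choose, once the elements
  coded by the smaller numbers in \<open>set_decode n\<close> are known to lie in the
  closure.\<close>

lemma hf_elem_props:
  "hf_elem \<sigma> x n \<in> Delta \<sigma> [x] \<and> the (\<sigma> (hf_elem \<sigma> x n)) = the (\<sigma> x) - hf_elem \<sigma> x ` set_decode n"
proof (induction n rule: less_induct)
  case (less n)
  have "x \<in> Delta \<sigma> [x]" using set_subset_Delta[of "[x]" \<sigma>] by simp
  moreover have "hf_elem \<sigma> x ` set_decode n \<subseteq> Delta \<sigma> [x]"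
    using less mem_set_decode_less by blast
  ultimately have "\<exists>v\<in>Delta \<sigma> [x]. the (\<sigma> v) = (the (\<sigma> x) - hf_elem \<sigma> x ` set_decode n) \<union> {}"
    by (intro Good1D[OF good]) auto
  then have "\<exists>v. v \<in> Delta \<sigma> [x] \<and> the (\<sigma> v) = the (\<sigma> x) - hf_elem \<sigma> x ` set_decode n"
    by auto
  from someI_ex[OF this] show ?case by (simp add: hf_elem.simps[symmetric])
qed

lemma hf_elem_Delta: "hf_elem \<sigma> x n \<in> Delta \<sigma> [x]"
  and hf_elem_value: "the (\<sigma> (hf_elem \<sigma> x n)) = the (\<sigma> x) - hf_elem \<sigma> x ` set_decode n"
  using hf_elem_props by auto

lemma hf_elem_dom: "hf_elem \<sigma> x n \<in> dom \<sigma>"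
  using hf_elem_Delta Delta_dom by blast

text \<open>Since \<open>v \<in> \<sigma>(v)\<close> and the value at a coded element is contained
  in that at \<open>x\<close>, coded elements belong to the latter. Hence the set removed can be
  read off from the value.\<close>

lemma hf_elem_mem_base: "hf_elem \<sigma> x n \<in> the (\<sigma> x)"
proof -
  have "hf_elem \<sigma> x n \<in> the (\<sigma> (hf_elem \<sigma> x n))"
    using \<sigma> hf_elem_dom unfolding PP_def by blast
  then show ?thesis using hf_elem_value by blast
qed

lemma hf_elem_0: "hf_elem \<sigma> x 0 = x"
proof (rule PP_inj[OF \<sigma> hf_elem_dom])
  show "x \<in> dom \<sigma>" using Delta_dom set_subset_Delta[of "[x]" \<sigma>] by auto
  show "the (\<sigma> (hf_elem \<sigma> x 0)) = the (\<sigma> x)" by (simp add: hf_elem_value)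
qed

text \<open>Equal elements have equal removed sets. Induction on one code, with the other arbitrary,
  turns equality of these images into equality of the digit sets, which determine the codes.\<close>

lemma inj_hf_elem: "inj (hf_elem \<sigma> x)"
proof -
  have "\<forall>m. hf_elem \<sigma> x m = hf_elem \<sigma> x n \<longrightarrow> m = n" for n
  proof (induction n rule: less_induct)
    case (less n)
    show ?case
    proof (intro allI impI)
      fix m assume eq: "hf_elem \<sigma> x m = hf_elem \<sigma> x n"
      have "the (\<sigma> x) - hf_elem \<sigma> x ` set_decode m = the (\<sigma> x) - hf_elem \<sigma> x ` set_decode n"
        by (metis eq hf_elem_value)
      then have im: "hf_elem \<sigma> x ` set_decode m = hf_elem \<sigma> x ` set_decode n"
        using hf_elem_mem_base by blast
      have step: "i = j" if "j \<in> set_decode n" "hf_elem \<sigma> x i = hf_elem \<sigma> x j" for i j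
        using less that mem_set_decode_less by blast
      have "set_decode m = set_decode n"
      proof
        show "set_decode m \<subseteq> set_decode n"
        proof
          fix i assume "i \<in> set_decode m"
          then obtain j where "j \<in> set_decode n" "hf_elem \<sigma> x i = hf_elem \<sigma> x j"
            using im by blast
          then show "i \<in> set_decode n" using step by blast
        qed
        show "set_decode n \<subseteq> set_decode m"
        proof
          fix j assume j: "j \<in> set_decode n"
          then obtain i where "i \<in> set_decode m" "hf_elem \<sigma> x i = hf_elem \<sigma> x j"
            using im by (metis imageE imageI)
          then show "j \<in> set_decode m" using step j by blast
        qed
      qed
      then show "m = n" by (metis set_decode_inverse)
    qed
  qed
  then show ?thesis unfolding inj_def by blast
qed

text \<open>The range contains \<open>x\<close>, as code 0, and is closed, so it includes the least
  closed set.\<close>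

lemma range_hf_elem: "range (hf_elem \<sigma> x) = Delta \<sigma> [x]"
proof
  let ?R = "range (hf_elem \<sigma> x)"
  show "?R \<subseteq> Delta \<sigma> [x]" using hf_elem_Delta by blast
  show "Delta \<sigma> [x] \<subseteq> ?R"
  proof (rule Delta_least)
    show "set [x] \<subseteq> ?R" using rangeI[of "hf_elem \<sigma> x" 0] hf_elem_0 by simp
    show "closed_under \<sigma> ?R"
      unfolding closed_under_def
    proof (intro conjI ballI allI impI)
      fix u v assume "u \<in> ?R \<inter> dom \<sigma>" "v \<in> ?R \<inter> dom \<sigma>"
      then obtain m n where "u = hf_elem \<sigma> x m" "v = hf_elem \<sigma> x n" by blast
      then show "the (\<sigma> u) - the (\<sigma> v) \<subseteq> ?R"
        using hf_elem_value[of m] hf_elem_value[of n] by blast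
    next
      fix u v A B
      assume "u \<in> ?R \<inter> dom \<sigma>" and v: "v \<in> dom \<sigma>"
        and AB: "finite A \<and> A \<subseteq> ?R \<and> finite B \<and> B \<subseteq> ?R \<and> the (\<sigma> v) = (the (\<sigma> u) - A) \<union> B"
      then obtain n where n: "u = hf_elem \<sigma> x n" by blast
      \<comment> \<open>Removing \<open>A\<close> enlarges the removed set, and adding
        \<open>B\<close> shrinks it because \<open>B\<close> is contained in the value at
        \<open>x\<close>. The result is again that value minus a finite coded set.\<close>
      let ?C = "hf_elem \<sigma> x ` set_decode n \<union> A - B"
      have "finite ?C" "?C \<subseteq> ?R" using AB by auto
      then obtain N where N: "finite N" "?C = hf_elem \<sigma> x ` N"
        by (meson finite_subset_image)
      let ?m = "set_encode N"
      have "the (\<sigma> v) = the (\<sigma> x) - ?C"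
        using AB hf_elem_mem_base unfolding n hf_elem_value by blast
      also have "\<dots> = the (\<sigma> (hf_elem \<sigma> x ?m))"
        unfolding hf_elem_value N(2) by (simp add: N(1))
      finally have "v = hf_elem \<sigma> x ?m" by (rule PP_inj[OF \<sigma> v hf_elem_dom])
      then show "v \<in> ?R" by blast
    qed
  qed
qed

text \<open>The relation on codes mentions neither \<open>\<sigma>\<close> nor \<open>x\<close>, so
  it is a common model for the closures of all good elements.\<close>

lemma isomorphism_hf_elem:
  "isomorphism (hf_elem \<sigma> x) UNIV (\<lambda>m n. m \<notin> set_decode n) (Delta \<sigma> [x]) (mem_of \<sigma>)"
proof -
  have "mem_of \<sigma> (hf_elem \<sigma> x m) (hf_elem \<sigma> x n) \<longleftrightarrow> m \<notin> set_decode n" for m n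
    unfolding mem_of_def hf_elem_value
    using hf_elem_dom hf_elem_mem_base inj_hf_elem by (simp add: inj_image_mem_iff)
  then show ?thesis
    unfolding isomorphism_def bij_betw_def using inj_hf_elem range_hf_elem by simp
qed

end

lemma isomorphism_comp:
  assumes "isomorphism f A R B S" "isomorphism g B S C T"
  shows "isomorphism (g \<circ> f) A R C T"
proof -
  have "bij_betw (g \<circ> f) A C"
    using assms bij_betw_trans unfolding isomorphism_def by blast
  moreover have "f u \<in> B" if "u \<in> A" for u
    using assms(1) that bij_betw_apply unfolding isomorphism_def by fastforce
  ultimately show ?thesis using assms unfolding isomorphism_def by simp
qed

text \<open>Decode at \<open>y\<close> what was encoded at \<open>x\<close>; both base points have
  code 0.\<close>

lemma Good2_singleton:
  assumes \<sigma>: "\<sigma> \<in> PP" and x: "Good1 \<sigma> [x]" and y: "Good1 \<sigma> [y]"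
  shows "Good2 \<sigma> [(x, y)]"
proof -
  let ?f = "hf_elem \<sigma> y \<circ> inv (hf_elem \<sigma> x)"
  have "isomorphism ?f (Delta \<sigma> [x]) (mem_of \<sigma>) (Delta \<sigma> [y]) (mem_of \<sigma>)"
    using isomorphism_comp[OF isomorphism_inv_into[OF isomorphism_hf_elem[OF \<sigma> x]]
        isomorphism_hf_elem[OF \<sigma> y]] .
  moreover have "inv (hf_elem \<sigma> x) x = 0"
    using inv_f_f[OF inj_hf_elem[OF \<sigma> x], of 0] by (simp add: hf_elem_0[OF \<sigma> x])
  ultimately show ?thesis
    unfolding Good2_def using x y hf_elem_0[OF \<sigma> y] by auto
qed

text \<open>The empty list has empty closure, so it is good for every map. This is where genericity
  can begin producing good elements.\<close>

lemma Good2_Nil: "Good2 \<sigma> []"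
proof -
  have "closed_under \<sigma> {}" unfolding closed_under_def by simp
  then have "Delta \<sigma> [] = {}" using Delta_least[of "[]" "{}" \<sigma>] by simp
  then show ?thesis unfolding Good2_def Good1_def isomorphism_def bij_betw_def by simp
qed

section \<open>Back and forth between countable structures\<close>

lemma back_and_forth:
  fixes R :: "'a \<Rightarrow> 'a \<Rightarrow> bool" and S :: "'b \<Rightarrow> 'b \<Rightarrow> bool"
  assumes d: "surj (d :: nat \<Rightarrow> 'a)" and e: "surj (e :: nat \<Rightarrow> 'b)"
    and forth: "\<And>ps a. Q ps \<Longrightarrow> \<exists>b. Q (ps @ [(a, b)])"
    and bck: "\<And>ps b. Q ps \<Longrightarrow> \<exists>a. Q (ps @ [(a, b)])"
    and inj: "\<And>ps x y x' y'. Q ps \<Longrightarrow> (x, y) \<in> set ps \<Longrightarrow> (x', y') \<in> set ps \<Longrightarrow> x = x' \<longleftrightarrow> y = y'"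
    and rel: "\<And>ps x y x' y'. Q ps \<Longrightarrow> (x, y) \<in> set ps \<Longrightarrow> (x', y') \<in> set ps \<Longrightarrow> R x x' \<longleftrightarrow> S y y'"
    and start: "Q ps"
  shows "\<exists>F. isomorphism F UNIV R UNIV S \<and> (\<forall>(x, y)\<in>set ps. F x = y)"
proof -
  \<comment> \<open>Stage \<open>n\<close> puts \<open>d n\<close> into the domain and then
    \<open>e n\<close> into the range, keeping all earlier pairs.\<close>
  have "\<exists>P. \<forall>n. (Q (P n) \<and> set ps \<subseteq> set (P n)) \<and>
          (\<exists>b a. P (Suc n) = P n @ [(d n, b)] @ [(a, e n)])"
  proof (rule dependent_nat_choice)
    show "\<exists>qs. Q qs \<and> set ps \<subseteq> set qs" using start by blast
    fix qs n assume qs: "Q qs \<and> set ps \<subseteq> set qs"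
    then obtain b where "Q (qs @ [(d n, b)])" using forth by blast
    then obtain a where "Q (qs @ [(d n, b)] @ [(a, e n)])" using bck by fastforce
    then show "\<exists>rs. (Q rs \<and> set ps \<subseteq> set rs) \<and> (\<exists>b a. rs = qs @ [(d n, b)] @ [(a, e n)])"
      using qs by (intro exI[of _ "qs @ [(d n, b)] @ [(a, e n)]"]) auto
  qed
  then obtain P where Q: "\<And>n. Q (P n)" and ps: "\<And>n. set ps \<subseteq> set (P n)"
    and step: "\<And>n. \<exists>b a. P (Suc n) = P n @ [(d n, b)] @ [(a, e n)]"
    by blast
  have "set (P n) \<subseteq> set (P (Suc n))" for n
    using step[of n] by auto
  then have mono: "set (P m) \<subseteq> set (P n)" if "m \<le> n" for m n
    using that by (rule lift_Suc_mono_le)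
  \<comment> \<open>The graph of the isomorphism. Any two of its pairs occur together at some stage,
    so \<open>inj\<close> and \<open>rel\<close> pass to it.\<close>
  define C where "C = (\<Union>n. set (P n))"
  have common: "\<exists>n. (x, y) \<in> set (P n) \<and> (x', y') \<in> set (P n)"
    if "(x, y) \<in> C" "(x', y') \<in> C" for x y x' y'
  proof -
    obtain m n where "(x, y) \<in> set (P m)" "(x', y') \<in> set (P n)"
      using \<open>(x, y) \<in> C\<close> \<open>(x', y') \<in> C\<close> unfolding C_def by blast
    then show ?thesis using mono[of m "max m n"] mono[of n "max m n"] by auto
  qed
  have C_inj: "x = x' \<longleftrightarrow> y = y'" and C_rel: "R x x' \<longleftrightarrow> S y y'"
    if "(x, y) \<in> C" "(x', y') \<in> C" for x y x' y'
    using common[OF that] inj[OF Q] rel[OF Q] by blast+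
  have total: "\<exists>y. (x, y) \<in> C" for x
  proof -
    obtain n where "x = d n" using d by (metis surjD)
    then have "\<exists>y. (x, y) \<in> set (P (Suc n))" using step[of n] by auto
    then show ?thesis unfolding C_def by blast
  qed
  have onto: "\<exists>x. (x, y) \<in> C" for y
  proof -
    obtain n where "y = e n" using e by (metis surjD)
    then have "\<exists>x. (x, y) \<in> set (P (Suc n))" using step[of n] by auto
    then show ?thesis unfolding C_def by blast
  qed
  obtain F where F: "\<And>x. (x, F x) \<in> C" using total by metis
  have "F x = y" if "(x, y) \<in> C" for x y using C_inj[OF F[of x] that] by simp
  moreover have "set ps \<subseteq> C" using ps[of 0] unfolding C_def by blast
  moreover have "bij F"
    unfolding bij_def inj_def surj_def using C_inj[OF F F] onto calculation(1) by metis
  moreover have "\<forall>x x'. R x x' \<longleftrightarrow> S (F x) (F x')" using C_rel[OF F F] by blast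
  ultimately show ?thesis unfolding isomorphism_def by blast
qed

section \<open>Countability of the constants and finite changes within \<open>XX\<close>\<close>

lemma surj_Cst_int_decode: "surj (\<lambda>n. Cst (int_decode n))"
proof (rule surjI)
  show "Cst (int_decode (case u of Cst i \<Rightarrow> int_encode i)) = u" for u by (cases u) simp
qed

lemma XX_finite_change:
  assumes "X \<in> XX" "finite (X - Y)" "finite (Y - X)"
  shows "Y \<in> XX"
proof -
  have "(Y - Cst ` {0..}) \<union> (Cst ` {0..} - Y)
      \<subseteq> ((X - Cst ` {0..}) \<union> (Cst ` {0..} - X)) \<union> ((X - Y) \<union> (Y - X))" by blast
  then show ?thesis using assms unfolding XX_def by (auto elim: finite_subset)
qed

lemma XX_finite_Diff:
  assumes "X \<in> XX" "Y \<in> XX"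
  shows "finite (X - Y)"
proof -
  have "X - Y \<subseteq> (X - Cst ` {0..}) \<union> (Cst ` {0..} - Y)" by blast
  then show ?thesis using assms unfolding XX_def by (auto elim: finite_subset)
qed

section \<open>Consequences of genericity\<close>

context
  fixes G
  assumes gen: "generic_ideal (T_family \<union> S_family \<union> G_family) G"
begin

lemma G_PP: "\<sigma> \<in> G \<Longrightarrow> \<sigma> \<in> PP"
  using gen unfolding generic_ideal_def by blast

lemma G_directed: "\<sigma> \<in> G \<Longrightarrow> \<tau> \<in> G \<Longrightarrow> \<exists>\<rho>\<in>G. \<sigma> \<subseteq>\<^sub>m \<rho> \<and> \<tau> \<subseteq>\<^sub>m \<rho>"
  using gen unfolding generic_ideal_def by simp

lemma G_meets:
  assumes "D \<in> T_family \<union> S_family \<union> G_family"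
  shows "\<exists>\<sigma>\<in>G. \<sigma> \<in> D"
proof -
  have "G \<inter> D \<noteq> {}"
    using gen assms unfolding generic_ideal_def by (elim conjE) (rule bspec)
  then show ?thesis by blast
qed

lemma star_iff: "(u, X) \<in> star G \<longleftrightarrow> (\<exists>\<sigma>\<in>G. \<sigma> u = Some X)"
  unfolding star_def Map.graph_def by auto

text \<open>By directedness a single condition carries both values, so \<open>star G\<close>
  inherits functionality and injectivity from its conditions.\<close>

lemma star_common:
  assumes "(u, X) \<in> star G" "(v, Y) \<in> star G"
  shows "\<exists>\<sigma>\<in>G. \<sigma> u = Some X \<and> \<sigma> v = Some Y"
proof -
  obtain \<sigma> \<tau> where "\<sigma> \<in> G" "\<sigma> u = Some X" "\<tau> \<in> G" "\<tau> v = Some Y"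
    using assms unfolding star_iff by blast
  then obtain \<rho> where "\<rho> \<in> G" "\<sigma> \<subseteq>\<^sub>m \<rho>" "\<tau> \<subseteq>\<^sub>m \<rho>" using G_directed by blast
  then have "\<rho> u = Some X" "\<rho> v = Some Y"
    using \<open>\<sigma> u = Some X\<close> \<open>\<tau> v = Some Y\<close> map_le_value by (metis domI)+
  then show ?thesis using \<open>\<rho> \<in> G\<close> by blast
qed

lemma star_total: "\<exists>X. (u, X) \<in> star G"
proof -
  obtain k where k: "u = Cst k" by (cases u)
  have "{\<sigma>\<in>PP. Cst k \<in> dom \<sigma>} \<in> T_family" unfolding T_family_def by blast
  then show ?thesis using G_meets[of "{\<sigma>\<in>PP. Cst k \<in> dom \<sigma>}"] unfolding star_iff k by blast
qed

lemma star_onto: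
  assumes "X \<in> XX"
  shows "\<exists>u. (u, X) \<in> star G"
proof -
  have "{\<sigma>\<in>PP. \<exists>k. \<sigma> (Cst k) = Some X} \<in> S_family" unfolding S_family_def using assms by blast
  then show ?thesis using G_meets[of "{\<sigma>\<in>PP. \<exists>k. \<sigma> (Cst k) = Some X}"] unfolding star_iff by blast
qed

lemma star_XX: "(u, X) \<in> star G \<Longrightarrow> X \<in> XX"
  unfolding star_iff using G_PP unfolding PP_def by (blast intro: ranI)

lemma star_bij: "\<exists>f. star G = {(u, f u) |u. True} \<and> bij_betw f UNIV XX"
proof -
  obtain f where f: "\<And>u. (u, f u) \<in> star G" using star_total by metis
  have unique: "f u = X" if "(u, X) \<in> star G" for u X
    using star_common[OF f[of u] that] by auto
  have "inj f"
  proof (rule injI)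
    fix u v assume "f u = f v"
    then obtain \<sigma> where "\<sigma> \<in> G" "\<sigma> u = Some (f u)" "\<sigma> v = Some (f u)"
      using star_common[OF f f, of u v] by auto
    then show "u = v" using PP_inj[OF G_PP, of \<sigma> u v] by auto
  qed
  moreover have "range f = XX"
    using star_onto unique star_XX[OF f] by blast
  moreover have "star G = {(u, f u) |u. True}" using f unique by auto
  ultimately show ?thesis unfolding bij_betw_def by blast
qed

text \<open>The value at \<open>v\<close> never changes after it is first defined, so one condition
  already decides the members of \<open>v\<close>.\<close>

lemma mem_star_eq_mem_of:
  assumes "\<sigma> \<in> G" "v \<in> dom \<sigma>"
  shows "mem_star G u v \<longleftrightarrow> mem_of \<sigma> u v"
proof -
  obtain X where X: "\<sigma> v = Some X" using assms(2) by blast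
  then have vX: "(v, X) \<in> star G" using assms(1) star_iff by blast
  have "Y = X" if "(v, Y) \<in> star G" for Y using star_common[OF that vX] by auto
  then have "mem_star G u v \<longleftrightarrow> u \<in> X" using vX unfolding mem_star_def by blast
  then show ?thesis using X by (simp add: mem_of_def domI)
qed

lemma Good2_forth:
  assumes "\<sigma> \<in> G" "Good2 \<sigma> ps"
  shows "\<exists>b. \<exists>\<tau>\<in>G. Good2 \<tau> (ps @ [(a, b)])"
proof -
  let ?D = "{\<sigma>\<in>PP. (\<exists>b. Good2 \<sigma> (ps @ [(a, b)]))
             \<or> \<not> (\<exists>\<tau>\<in>PP. \<sigma> \<subseteq>\<^sub>m \<tau> \<and> Good2 \<tau> ps)}"
  have "?D \<in> G_family" unfolding G_family_def by blast
  then obtain \<tau> where \<tau>: "\<tau> \<in> G" "\<tau> \<in> ?D" using G_meets[of ?D] by blast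
  obtain \<rho> where \<rho>: "\<rho> \<in> G" "\<sigma> \<subseteq>\<^sub>m \<rho>" "\<tau> \<subseteq>\<^sub>m \<rho>" using G_directed assms(1) \<tau>(1) by blast
  then have "Good2 \<rho> ps" using Good2_mono assms(2) G_PP by blast
  \<comment> \<open>\<open>\<rho>\<close> extends \<open>\<tau>\<close> and makes \<open>ps\<close>
    good, which refutes the second alternative for \<open>\<tau>\<close>; hence
    \<open>\<tau>\<close> itself supplies \<open>b\<close>.\<close>
  then show ?thesis using \<tau> \<rho> G_PP by blast
qed

lemma Good2_back:
  assumes "\<sigma> \<in> G" "Good2 \<sigma> ps"
  shows "\<exists>a. \<exists>\<tau>\<in>G. Good2 \<tau> (ps @ [(a, b)])"
proof -
  obtain a \<tau> where \<tau>: "\<tau> \<in> G" "Good2 \<tau> (map prod.swap ps @ [(b, a)])"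
    using Good2_forth[OF assms(1) Good2_swap[OF assms(2)]] by blast
  have "map prod.swap (map prod.swap ps @ [(b, a)]) = ps @ [(a, b)]"
    by (simp add: comp_def)
  then show ?thesis using Good2_swap[OF \<tau>(2)] \<tau>(1) by metis
qed

text \<open>Extending the empty list makes \<open>x\<close> and \<open>y\<close> good separately,
  each with its own condition. A common extension keeps both good, and two good elements always form
  a good pair.\<close>

lemma Good2_start: "\<exists>\<sigma>\<in>G. Good2 \<sigma> [(x, y)]"
proof -
  have G1: "\<exists>\<sigma>\<in>G. Good1 \<sigma> [z]" for z
  proof -
    obtain \<sigma> where "\<sigma> \<in> G" using gen unfolding generic_ideal_def by blast
    then show ?thesis using Good2_forth[OF _ Good2_Nil, of \<sigma> z] unfolding Good2_def by auto
  qed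
  obtain \<sigma> \<tau> where \<sigma>: "\<sigma> \<in> G" "Good1 \<sigma> [x]" and \<tau>: "\<tau> \<in> G" "Good1 \<tau> [y]" using G1 by blast
  obtain \<rho> where \<rho>: "\<rho> \<in> G" "\<sigma> \<subseteq>\<^sub>m \<rho>" "\<tau> \<subseteq>\<^sub>m \<rho>" using G_directed \<sigma>(1) \<tau>(1) by blast
  then show ?thesis
    using Good2_singleton Good1_mono(2) \<sigma>(2) \<tau>(2) G_PP by metis
qed

lemma mem_star_homogeneous:
  "\<exists>F. isomorphism F UNIV (mem_star G) UNIV (mem_star G) \<and> F x = y"
proof -
  have "\<exists>F. isomorphism F UNIV (mem_star G) UNIV (mem_star G) \<and> (\<forall>(u, v)\<in>set [(x, y)]. F u = v)"
  proof (rule back_and_forth[OF surj_Cst_int_decode surj_Cst_int_decode,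
        where Q = "\<lambda>ps. \<exists>\<sigma>\<in>G. Good2 \<sigma> ps"])
    show "\<exists>b. \<exists>\<sigma>\<in>G. Good2 \<sigma> (ps @ [(a, b)])" if "\<exists>\<sigma>\<in>G. Good2 \<sigma> ps" for ps a
      using that Good2_forth by blast
    show "\<exists>a. \<exists>\<sigma>\<in>G. Good2 \<sigma> (ps @ [(a, b)])" if "\<exists>\<sigma>\<in>G. Good2 \<sigma> ps" for ps b
      using that Good2_back by blast
    show "u = u' \<longleftrightarrow> v = v'"
      if "\<exists>\<sigma>\<in>G. Good2 \<sigma> ps" "(u, v) \<in> set ps" "(u', v') \<in> set ps" for ps u v u' v'
      using that Good2_pairs(1) by blast
    show "mem_star G u u' \<longleftrightarrow> mem_star G v v'"
      if good: "\<exists>\<sigma>\<in>G. Good2 \<sigma> ps" and pairs: "(u, v) \<in> set ps" "(u', v') \<in> set ps"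
      for ps u v u' v'
    proof -
      obtain \<sigma> where \<sigma>: "\<sigma> \<in> G" "Good2 \<sigma> ps" using good by blast
      show ?thesis
        \<comment> \<open>The second pair is used twice because only the right-hand arguments
          \<open>u'\<close> and \<open>v'\<close> have to be in the domain of
          \<open>\<sigma>\<close>.\<close>
        using Good2_pairs(2)[OF \<sigma>(2) pairs] Good2_pairs(3,4)[OF \<sigma>(2) pairs(2,2)]
          mem_star_eq_mem_of[OF \<sigma>(1)] by blast
    qed
    show "\<exists>\<sigma>\<in>G. Good2 \<sigma> [(x, y)]" by (rule Good2_start)
  qed
  then show ?thesis by simp
qed

end

theorem theorem2:
  fixes G :: "pmap set"
  assumes "generic_ideal (T_family \<union> S_family \<union> G_family) G"
  shows "(\<exists>f. star G = {(u, f u) |u. True} \<and> bij_betw f UNIV XX)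
       \<and> sat_WD (mem_star G) \<and> sat_EXT (mem_star G)
       \<and> sat_BU (mem_star G) \<and> sat_BI (mem_star G)
       \<and> (\<forall>k l. \<exists>F. isomorphism F UNIV (mem_star G) UNIV (mem_star G)
                    \<and> F (Cst k) = Cst l)"
proof -
  obtain f where f: "star G = {(u, f u) |u. True}" "bij_betw f UNIV XX"
    using star_bij[OF assms] by blast
  have mem: "mem_star G u v \<longleftrightarrow> u \<in> f v" for u v
    unfolding mem_star_def f(1) by auto
  have in_XX: "f u \<in> XX" for u using f(2) by (simp add: bij_betw_apply)
  \<comment> \<open>As \<open>f\<close> maps onto \<open>XX\<close>, every finite modification of
    some \<open>f x\<close> is the extension of an element. The existence axioms thus reduce to
    finiteness of two differences.\<close>
  have ex: "\<exists>z. \<forall>u. mem_star G u z \<longleftrightarrow> u \<in> Y"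
    if "finite (f x - Y)" "finite (Y - f x)" for x Y
  proof -
    have "Y \<in> XX" using XX_finite_change[OF in_XX that] .
    then have "Y \<in> range f" using f(2) by (simp add: bij_betw_def)
    then obtain z where "f z = Y" by auto
    then show ?thesis using mem by blast
  qed
  have fin: "finite (f x - f y)" for x y by (rule XX_finite_Diff[OF in_XX in_XX])
  have "sat_WD (mem_star G)"
    unfolding sat_WD_def mem
  proof (intro conjI allI)
    fix x y
    show "\<exists>z. \<forall>u. u \<in> f z \<longleftrightarrow> u \<in> f x \<or> u = y"
      using ex[of x "insert y (f x)"] unfolding mem by (simp add: insert_Diff_if disj_commute)
    have "f x - (f x - {y}) \<subseteq> {y}" by blast
    then have "finite (f x - (f x - {y}))" by (rule finite_subset) simp
    moreover have "finite (f x - {y} - f x)" by (rule finite_subset[of _ "{}"]) auto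
    ultimately show "\<exists>z. \<forall>u. u \<in> f z \<longleftrightarrow> u \<in> f x \<and> u \<noteq> y"
      using ex[of x "f x - {y}"] unfolding mem by simp
  qed
  moreover have "sat_EXT (mem_star G)"
    unfolding sat_EXT_def mem using f(2) unfolding bij_betw_def inj_def by blast
  moreover have "sat_BU (mem_star G)"
    unfolding sat_BU_def mem
  proof (intro allI)
    fix x y
    show "\<exists>z. \<forall>u. u \<in> f z \<longleftrightarrow> u \<in> f x \<or> u \<in> f y"
    proof -
      have "finite (f x - (f x \<union> f y))" by (rule finite_subset[of _ "{}"]) auto
      moreover have "finite (f x \<union> f y - f x)" using fin by (simp add: Un_Diff)
      ultimately show ?thesis using ex[of x "f x \<union> f y"] unfolding mem by simp
    qed
  qed
  moreover have "sat_BI (mem_star G)"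
    unfolding sat_BI_def mem
  proof (intro allI)
    fix x y
    show "\<exists>z. \<forall>u. u \<in> f z \<longleftrightarrow> u \<in> f x \<and> u \<in> f y"
    proof -
      have "finite (f x - f x \<inter> f y)" using fin by (simp add: Diff_Int)
      moreover have "finite (f x \<inter> f y - f x)" by (rule finite_subset[of _ "{}"]) auto
      ultimately show ?thesis using ex[of x "f x \<inter> f y"] unfolding mem by simp
    qed
  qed
  ultimately show ?thesis using f mem_star_homogeneous[OF assms] by blast
qed

end
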